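(* Let $R=\mathbb Z[u_{s,i}^{\pm1},u_{t,j}^{\pm1}]_{1\le i\le 2,\,1\le j\le 3}$ and let $$H_{G_6}=\Big\langle s,t\ \Big|\ ststst=tststs,\ \prod_{i=1}^2(s-u_{s,i})=\prod_{j=1}^3(t-u_{t,j})=0\Big\rangle$$ be the generic Hecke algebra (an associative unital $R$-algebra) of $G_6$. Let $u_1,u_2$ be the $R$-subalgebras generated by $s$ and by $t$ respectively, let $z=(st)^3$, and let $U=\sum_{k=0}^3z^ku_2u_1u_2$. Then $H_{G_6}=U$.
   Context: For subsets $X,Y$ of an $R$-algebra, $XY$ denotes the $R$-submodule spanned by the products $xy$. *)

theory Defs
  imports Complex_Main "HOL-Library.Poly_Mapping" "HOL-Library.Set_Algebras"
begin

datatype param = Us1 | Us2 | Ut1 | Ut2 | Ut3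

text \<open>
  A Laurent monomial is an exponent vector \<^typ>\<open>param \<Rightarrow>\<^sub>0 int\<close>. The convolution product
  of \<^theory>\<open>HOL-Library.Poly_Mapping\<close> then makes \<open>laurent\<close> the group ring over the integers
  of the free abelian group on the five parameters, i.e. the Laurent polynomial ring.
\<close>
type_synonym laurent = "(param \<Rightarrow>\<^sub>0 int) \<Rightarrow>\<^sub>0 int"

definition upar :: "param \<Rightarrow> laurent" where
  "upar p = Poly_Mapping.single (Poly_Mapping.single p 1) 1"

lemma upar_unit: "upar p * Poly_Mapping.single (Poly_Mapping.single p (-1)) 1 = 1"
  by (simp add: upar_def mult_single flip: single_add)

datatype gen = Gs | Gt

text \<open>
  The free monoid on the generators is written additively, because
  \<^theory>\<open>HOL-Library.Poly_Mapping\<close> expects an additive monoid of exponents.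
\<close>
datatype word = Word "gen list"

instantiation word :: monoid_add
begin

definition zero_word :: word where
  "0 = Word []"

fun plus_word :: "word \<Rightarrow> word \<Rightarrow> word" where
  "Word v + Word w = Word (v @ w)"

instance
proof
  fix a b c :: word
  show "a + b + c = a + (b + c)"
    by (cases a; cases b; cases c) simp
  show "0 + a = a" "a + 0 = a"
    by (cases a; simp add: zero_word_def)+
qed

end

type_synonym free_alg = "word \<Rightarrow>\<^sub>0 laurent"

definition free_const :: "laurent \<Rightarrow> free_alg" where
  "free_const r = Poly_Mapping.single 0 r"

definition free_s :: free_alg where
  "free_s = Poly_Mapping.single (Word [Gs]) 1"

definition free_t :: free_alg where
  "free_t = Poly_Mapping.single (Word [Gt]) 1"

lemma free_const_simps:
  "free_const 0 = 0" "free_const 1 = 1"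
  "free_const (a + b) = free_const a + free_const b" "free_const (a * b) = free_const a * free_const b"
  by (simp_all add: free_const_def single_add mult_single)

lemma update_eq_add_single:
  fixes f :: "'a \<Rightarrow>\<^sub>0 'b::comm_ring_1"
  assumes "k \<notin> Poly_Mapping.keys f"
  shows "Poly_Mapping.update k v f = f + Poly_Mapping.single k v"
  using assms
  by (intro poly_mapping_eqI)
    (auto simp: lookup_update lookup_add lookup_single when_def in_keys_iff)

lemma free_const_central: "free_const r * f = f * free_const r"
proof (induction f rule: update_induct)
  case const
  show ?case by simp
next
  case (update f k v)
  have "free_const r * Poly_Mapping.single k v = Poly_Mapping.single k v * free_const r"
    by (simp add: free_const_def mult_single mult.commute)
  with update show ?case
    by (simp add: update_eq_add_single distrib_left distrib_right)
qed

definition two_sided_ideal :: "'a::ring_1 set \<Rightarrow> bool" where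
  "two_sided_ideal I \<longleftrightarrow> 0 \<in> I \<and> (\<forall>x\<in>I. \<forall>y\<in>I. x + y \<in> I) \<and> (\<forall>x\<in>I. \<forall>a. a * x \<in> I \<and> x * a \<in> I)"

lemma two_sided_ideal_Inter:
  "(\<And>I. I \<in> \<I> \<Longrightarrow> two_sided_ideal I) \<Longrightarrow> two_sided_ideal (\<Inter>\<I>)"
  unfolding two_sided_ideal_def by blast

definition relators :: "free_alg set" where
  "relators =
    {free_s * free_t * free_s * free_t * free_s * free_t - free_t * free_s * free_t * free_s * free_t * free_s,
     (free_s - free_const (upar Us1)) * (free_s - free_const (upar Us2)),
     (free_t - free_const (upar Ut1)) * (free_t - free_const (upar Ut2)) * (free_t - free_const (upar Ut3))}"

definition hecke_ideal :: "free_alg set" where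
  "hecke_ideal = two_sided_ideal hull relators"

lemma two_sided_ideal_hecke_ideal: "two_sided_ideal hecke_ideal"
  unfolding hecke_ideal_def by (rule hull_in) (rule two_sided_ideal_Inter, blast)

lemma relators_subset_hecke_ideal: "relators \<subseteq> hecke_ideal"
  unfolding hecke_ideal_def by (rule hull_subset)

lemma hecke_ideal_zero: "0 \<in> hecke_ideal"
  and hecke_ideal_add: "x \<in> hecke_ideal \<Longrightarrow> y \<in> hecke_ideal \<Longrightarrow> x + y \<in> hecke_ideal"
  and hecke_ideal_mult_left: "x \<in> hecke_ideal \<Longrightarrow> a * x \<in> hecke_ideal"
  and hecke_ideal_mult_right: "x \<in> hecke_ideal \<Longrightarrow> x * a \<in> hecke_ideal"
  using two_sided_ideal_hecke_ideal by (auto simp: two_sided_ideal_def)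

lemma hecke_ideal_uminus: "x \<in> hecke_ideal \<Longrightarrow> - x \<in> hecke_ideal"
  using hecke_ideal_mult_left[of x "-1"] by simp

lemma hecke_ideal_minus: "x \<in> hecke_ideal \<Longrightarrow> y \<in> hecke_ideal \<Longrightarrow> x - y \<in> hecke_ideal"
  using hecke_ideal_add[of x "- y"] hecke_ideal_uminus[of y] by simp

text \<open>
  The ideal is proper (needed for \<open>ring_1\<close> below): summing coefficients, first of words and then
  of Laurent monomials, is a ring homomorphism to the integers that kills all relators.
\<close>
definition aug :: "('a \<Rightarrow>\<^sub>0 'b) \<Rightarrow> 'b::comm_ring_1" where
  "aug f = (\<Sum>k\<in>Poly_Mapping.keys f. Poly_Mapping.lookup f k)"

lemma aug_superset:
  "finite A \<Longrightarrow> Poly_Mapping.keys f \<subseteq> A \<Longrightarrow> aug f = (\<Sum>k\<in>A. Poly_Mapping.lookup f k)"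
  unfolding aug_def by (rule sum.mono_neutral_left) (auto simp: in_keys_iff)

lemma aug_single [simp]: "aug (Poly_Mapping.single k v) = v"
  by (simp add: aug_def)

lemma aug_add [simp]: "aug (f + g) = aug f + aug g"
proof -
  let ?A = "Poly_Mapping.keys f \<union> Poly_Mapping.keys g"
  have "aug (f + g) = (\<Sum>k\<in>?A. Poly_Mapping.lookup (f + g) k)"
    by (rule aug_superset) (use Poly_Mapping.keys_add[of f g] in auto)
  also have "\<dots> = (\<Sum>k\<in>?A. Poly_Mapping.lookup f k) + (\<Sum>k\<in>?A. Poly_Mapping.lookup g k)"
    by (simp add: lookup_add sum.distrib)
  also have "\<dots> = aug f + aug g"
    by (simp add: aug_superset[of ?A])
  finally show ?thesis .
qed

lemma aug_zero [simp]: "aug 0 = 0"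
  by (simp add: aug_def)

lemma aug_minus [simp]: "aug (f - g) = aug f - aug g"
  using aug_add[of "f - g" g] by simp

lemma aug_mult [simp]:
  fixes f g :: "'a::monoid_add \<Rightarrow>\<^sub>0 'b::comm_ring_1"
  shows "aug (f * g) = aug f * aug g"
proof (induction f rule: update_induct)
  case const
  show ?case by simp
next
  case (update f k v)
  have "aug (Poly_Mapping.single k v * g) = v * aug g"
  proof (induction g rule: update_induct)
    case const
    show ?case by simp
  next
    case (update g l w)
    then show ?case
      by (simp add: update_eq_add_single distrib_left mult_single)
  qed
  then show ?case
    using update by (simp add: update_eq_add_single distrib_right)
qed

lemma aug_one [simp]: "aug (1 :: 'a::monoid_add \<Rightarrow>\<^sub>0 'b::comm_ring_1) = 1"
  by (metis aug_single single_one)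

lemma one_notin_hecke_ideal: "1 \<notin> hecke_ideal"
proof -
  let ?K = "{f :: free_alg. aug (aug f) = 0}"
  have "two_sided_ideal ?K"
    by (auto simp: two_sided_ideal_def)
  moreover have "relators \<subseteq> ?K"
    by (auto simp: relators_def free_s_def free_t_def free_const_def upar_def)
  ultimately have "hecke_ideal \<subseteq> ?K"
    unfolding hecke_ideal_def by (intro hull_minimal)
  then show ?thesis by auto
qed

definition hecke_rel :: "free_alg \<Rightarrow> free_alg \<Rightarrow> bool" where
  "hecke_rel x y \<longleftrightarrow> x - y \<in> hecke_ideal"

quotient_type hecke = free_alg / hecke_rel
proof (rule equivpI)
  show "reflp hecke_rel"
    by (simp add: reflp_def hecke_rel_def hecke_ideal_zero)
  show "symp hecke_rel"
    unfolding symp_def hecke_rel_def using hecke_ideal_uminus by fastforce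
  show "transp hecke_rel"
    unfolding transp_def hecke_rel_def using hecke_ideal_add by fastforce
qed

instantiation hecke :: ring_1
begin

lift_definition zero_hecke :: hecke is 0 .

lift_definition one_hecke :: hecke is 1 .

lift_definition plus_hecke :: "hecke \<Rightarrow> hecke \<Rightarrow> hecke" is "(+)"
  unfolding hecke_rel_def using hecke_ideal_add by (fastforce simp: add_diff_add)

lift_definition uminus_hecke :: "hecke \<Rightarrow> hecke" is uminus
proof -
  fix a b :: free_alg
  assume "hecke_rel a b"
  then have "- (a - b) \<in> hecke_ideal"
    unfolding hecke_rel_def by (rule hecke_ideal_uminus)
  then show "hecke_rel (- a) (- b)"
    by (simp add: hecke_rel_def)
qed

lift_definition minus_hecke :: "hecke \<Rightarrow> hecke \<Rightarrow> hecke" is "(-)"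
proof -
  fix a a' b b' :: free_alg
  assume "hecke_rel a a'" "hecke_rel b b'"
  then have "(a - a') - (b - b') \<in> hecke_ideal"
    unfolding hecke_rel_def by (rule hecke_ideal_minus)
  then show "hecke_rel (a - b) (a' - b')"
    by (simp add: hecke_rel_def algebra_simps)
qed

lift_definition times_hecke :: "hecke \<Rightarrow> hecke \<Rightarrow> hecke" is "(*)"
proof -
  fix a a' b b' :: free_alg
  assume "hecke_rel a a'" "hecke_rel b b'"
  then have "(a - a') * b + a' * (b - b') \<in> hecke_ideal"
    unfolding hecke_rel_def
    by (intro hecke_ideal_add hecke_ideal_mult_left hecke_ideal_mult_right)
  then show "hecke_rel (a * b) (a' * b')"
    by (simp add: hecke_rel_def algebra_simps)
qed

instance
proof
  fix a b c :: hecke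
  show "a + b + c = a + (b + c)" "a + b = b + a" "0 + a = a" "- a + a = 0" "a - b = a + - b"
    "a * b * c = a * (b * c)" "1 * a = a" "a * 1 = a"
    "(a + b) * c = a * c + b * c" "a * (b + c) = a * b + a * c"
    by (transfer, simp add: hecke_rel_def hecke_ideal_zero algebra_simps)+
  show "(0 :: hecke) \<noteq> 1"
    using hecke_ideal_uminus[of "- 1"] one_notin_hecke_ideal
    by transfer (auto simp: hecke_rel_def)
qed

end

lift_definition hecke_scale :: "laurent \<Rightarrow> hecke \<Rightarrow> hecke" is "\<lambda>r f. free_const r * f"
  unfolding hecke_rel_def
  by (metis hecke_ideal_mult_left right_diff_distrib)

lift_definition hecke_s :: hecke is free_s .

lift_definition hecke_t :: hecke is free_t .

global_interpretation hecke: module hecke_scale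
proof
  fix a b :: laurent and x y :: hecke
  show "hecke_scale a (x + y) = hecke_scale a x + hecke_scale a y"
    by transfer (simp add: hecke_rel_def hecke_ideal_zero distrib_left)
  show "hecke_scale (a + b) x = hecke_scale a x + hecke_scale b x"
    by transfer (simp add: hecke_rel_def hecke_ideal_zero free_const_simps distrib_right)
  show "hecke_scale a (hecke_scale b x) = hecke_scale (a * b) x"
    by transfer (simp add: hecke_rel_def hecke_ideal_zero free_const_simps mult.assoc)
  show "hecke_scale 1 x = x"
    by transfer (simp add: hecke_rel_def hecke_ideal_zero free_const_simps)
qed

lemma hecke_scale_mult:
  "hecke_scale r x * y = hecke_scale r (x * y)"
  "x * hecke_scale r y = hecke_scale r (x * y)"
proof -
  show "hecke_scale r x * y = hecke_scale r (x * y)"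
    by transfer (simp add: hecke_rel_def hecke_ideal_zero mult.assoc)
  show "x * hecke_scale r y = hecke_scale r (x * y)"
  proof transfer
    fix x y :: free_alg and r
    have "x * (free_const r * y) = free_const r * (x * y)"
      by (simp add: free_const_central[of r x] flip: mult.assoc)
    then show "hecke_rel (x * (free_const r * y)) (free_const r * (x * y))"
      by (simp add: hecke_rel_def hecke_ideal_zero)
  qed
qed

lemma hecke_relations:
  "hecke_s * hecke_t * hecke_s * hecke_t * hecke_s * hecke_t =
    hecke_t * hecke_s * hecke_t * hecke_s * hecke_t * hecke_s"
  "(hecke_s - hecke_scale (upar Us1) 1) * (hecke_s - hecke_scale (upar Us2) 1) = 0"
  "(hecke_t - hecke_scale (upar Ut1) 1) * (hecke_t - hecke_scale (upar Ut2) 1) *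
    (hecke_t - hecke_scale (upar Ut3) 1) = 0"
  by (transfer, use relators_subset_hecke_ideal in \<open>auto simp: hecke_rel_def relators_def\<close>)+

definition subalgebra :: "hecke set \<Rightarrow> bool" where
  "subalgebra A \<longleftrightarrow> hecke.subspace A \<and> 1 \<in> A \<and> (\<forall>x\<in>A. \<forall>y\<in>A. x * y \<in> A)"

definition hecke_u1 :: "hecke set" where
  "hecke_u1 = subalgebra hull {hecke_s}"

definition hecke_u2 :: "hecke set" where
  "hecke_u2 = subalgebra hull {hecke_t}"

definition span_prod :: "hecke set \<Rightarrow> hecke set \<Rightarrow> hecke set"  (infixl \<open>\<odot>\<close> 70) where
  "X \<odot> Y = hecke.span {x * y |x y. x \<in> X \<and> y \<in> Y}"

definition hecke_z :: hecke where
  "hecke_z = (hecke_s * hecke_t) ^ 3"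

text \<open>
  The sum below is the elementwise (Minkowski) sum of sets from
  \<^theory>\<open>HOL-Library.Set_Algebras\<close>, i.e. the sum of submodules.
\<close>
definition hecke_U :: "hecke set" where
  "hecke_U = (\<Sum>k = 0..3. {hecke_z ^ k} \<odot> hecke_u2 \<odot> hecke_u1 \<odot> hecke_u2)"

end

theory Submission
  imports Defs
begin

text \<open>
  Write \<open>s\<^sup>2 = a s - b\<close>. The braid relation gives \<open>s t s = z t\<^sup>-\<^sup>1 s\<^sup>-\<^sup>1 t\<^sup>-\<^sup>1\<close> and
  \<open>z s\<^sup>-\<^sup>1 t\<^sup>-\<^sup>1 s\<^sup>-\<^sup>1 = t s t\<close>, so that \<open>z\<^sup>k s x s \<in> U\<close> for all \<open>x \<in> u\<^sub>2\<close> when \<open>k\<close> is \<open>1\<close> or \<open>2\<close>.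
  For the extreme exponents \<open>0\<close> and \<open>3\<close> one more relation is needed:
  \<open>z\<^sup>2 s\<^sup>-\<^sup>1 t\<^sup>-\<^sup>2 s\<^sup>-\<^sup>1 = (t s t s) (s t s t) = a z t - b t s t\<^sup>2 s t\<close>.
  It reduces \<open>s t\<^sup>2 s\<close> to the exponent \<open>2\<close> and \<open>z\<^sup>3 s\<^sup>-\<^sup>1 t\<^sup>-\<^sup>2 s\<^sup>-\<^sup>1\<close> to the exponent \<open>1\<close>.
  Hence \<open>U\<close> is a right ideal containing \<open>1\<close>.
\<close>

section \<open>Generation by \<open>s\<close> and \<open>t\<close>\<close>

lemma subalgebraD:
  assumes "subalgebra A"
  shows "hecke.subspace A" "1 \<in> A" "x \<in> A \<Longrightarrow> y \<in> A \<Longrightarrow> x * y \<in> A"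
  using assms by (auto simp: subalgebra_def)

lemma subalgebra_Inter: "(\<And>A. A \<in> \<A> \<Longrightarrow> subalgebra A) \<Longrightarrow> subalgebra (\<Inter>\<A>)"
  unfolding subalgebra_def by (simp add: hecke.subspace_Inter)

lemma subalgebra_hull: "subalgebra (subalgebra hull X)"
  by (rule hull_in) (rule subalgebra_Inter, blast)

text \<open>Every class is represented by a combination of words, and a word is a product of
  generators. The lemma is later applied to the centralizer of \<open>hecke_z\<close> and to the
  right multipliers that preserve \<open>U_span\<close>.\<close>

lemma subalgebra_eq_UNIV:
  assumes A: "subalgebra A" and gens: "hecke_s \<in> A" "hecke_t \<in> A"
  shows "A = UNIV"
proof -
  note sub = subalgebraD[OF A]
  have one_word: "abs_hecke (Poly_Mapping.single (Word ws) 1) \<in> A" for ws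
  proof (induction ws)
    case Nil
    have "Poly_Mapping.single (Word []) 1 = (1 :: free_alg)"
      by (simp flip: zero_word_def)
    then show ?case
      using sub(2) by (simp add: one_hecke_def)
  next
    case (Cons g ws)
    have "Poly_Mapping.single (Word (g # ws)) 1
        = Poly_Mapping.single (Word [g]) 1 * (Poly_Mapping.single (Word ws) 1 :: free_alg)"
      by (simp add: mult_single)
    then have "abs_hecke (Poly_Mapping.single (Word (g # ws)) 1)
        = abs_hecke (Poly_Mapping.single (Word [g]) 1) * abs_hecke (Poly_Mapping.single (Word ws) 1)"
      by (simp add: times_hecke.abs_eq)
    moreover have "abs_hecke (Poly_Mapping.single (Word [g]) 1) \<in> A"
      using gens by (cases g) (simp_all add: hecke_s_def hecke_t_def free_s_def free_t_def)
    ultimately show ?case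
      using Cons sub(3) by simp
  qed
  have "abs_hecke f \<in> A" for f
  proof (induction f rule: update_induct)
    case const
    show ?case
      using hecke.subspace_0[OF sub(1)] by (simp add: zero_hecke_def)
  next
    case (update f w v)
    obtain ws where w: "w = Word ws" by (cases w)
    have "Poly_Mapping.single w v = free_const v * Poly_Mapping.single w 1"
      by (simp add: free_const_def mult_single)
    then have "abs_hecke (Poly_Mapping.single w v) \<in> A"
      using hecke.subspace_scale[OF sub(1) one_word[of ws], of v]
      by (simp add: hecke_scale.abs_eq w)
    then show ?case
      using update hecke.subspace_add[OF sub(1)]
      by (simp add: update_eq_add_single flip: plus_hecke.abs_eq)
  qed
  then have "x \<in> A" for x
    by (induction x rule: hecke.abs_induct)
  then show ?thesis by blast
qed

lemma subalgebra_span: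
  assumes one: "1 \<in> hecke.span B"
    and mult: "\<And>x y. x \<in> B \<Longrightarrow> y \<in> B \<Longrightarrow> x * y \<in> hecke.span B"
  shows "subalgebra (hecke.span B)"
proof -
  have left: "x * y \<in> hecke.span B" if x: "x \<in> B" and y: "y \<in> hecke.span B" for x y
    using y
  proof (induction rule: hecke.span_induct_alt)
    case (step c b y)
    then show ?case
      using mult[OF x] by (simp add: distrib_left hecke_scale_mult hecke.span_add hecke.span_scale)
  qed (simp add: hecke.span_zero)
  have "x * y \<in> hecke.span B" if x: "x \<in> hecke.span B" and y: "y \<in> hecke.span B" for x y
    using x
  proof (induction rule: hecke.span_induct_alt)
    case (step c b x)
    then show ?case
      using left[OF _ y] by (simp add: distrib_right hecke_scale_mult hecke.span_add hecke.span_scale)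
  qed (simp add: hecke.span_zero)
  with one show ?thesis
    by (simp add: subalgebra_def)
qed

section \<open>The generators and their inverses\<close>

definition upar_inv :: "param \<Rightarrow> laurent" where
  "upar_inv p = Poly_Mapping.single (Poly_Mapping.single p (-1)) 1"

lemma upar_mult_inv: "upar p * upar_inv p = 1"
  unfolding upar_inv_def by (rule upar_unit)

text \<open>The coefficients a and b of the overview are \<open>s_tr\<close> and
  \<open>s_det\<close>: trace and determinant of a 2 by 2 matrix with eigenvalues
  \<open>upar Us1\<close>, \<open>upar Us2\<close>. Likewise \<open>t_e1\<close>,
  \<open>t_e2\<close>, \<open>t_e3\<close> are the elementary symmetric polynomials of the three
  roots for \<open>hecke_t\<close>.\<close>

definition s_tr :: laurent where
  "s_tr = upar Us1 + upar Us2"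

definition s_det :: laurent where
  "s_det = upar Us1 * upar Us2"

definition t_e1 :: laurent where
  "t_e1 = upar Ut1 + upar Ut2 + upar Ut3"

definition t_e2 :: laurent where
  "t_e2 = upar Ut1 * upar Ut2 + upar Ut1 * upar Ut3 + upar Ut2 * upar Ut3"

definition t_e3 :: laurent where
  "t_e3 = upar Ut1 * upar Ut2 * upar Ut3"

definition s_det_inv :: laurent where
  "s_det_inv = upar_inv Us1 * upar_inv Us2"

definition t_e3_inv :: laurent where
  "t_e3_inv = upar_inv Ut1 * upar_inv Ut2 * upar_inv Ut3"

lemma s_det_mult_inv: "s_det * s_det_inv = 1"
proof -
  have "s_det * s_det_inv = (upar Us1 * upar_inv Us1) * (upar Us2 * upar_inv Us2)"
    by (simp add: s_det_def s_det_inv_def mult_ac)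
  then show ?thesis by (simp add: upar_mult_inv)
qed

lemma t_e3_mult_inv: "t_e3 * t_e3_inv = 1"
proof -
  have "t_e3 * t_e3_inv =
      (upar Ut1 * upar_inv Ut1) * (upar Ut2 * upar_inv Ut2) * (upar Ut3 * upar_inv Ut3)"
    by (simp add: t_e3_def t_e3_inv_def mult_ac)
  then show ?thesis by (simp add: upar_mult_inv)
qed

lemma s_square: "hecke_s * hecke_s = hecke_scale s_tr hecke_s - hecke_scale s_det 1"
  using hecke_relations(2)
  by (simp add: s_tr_def s_det_def algebra_simps hecke_scale_mult)

lemma t_cube:
  "hecke_t * hecke_t * hecke_t =
    hecke_scale t_e1 (hecke_t * hecke_t) - hecke_scale t_e2 hecke_t + hecke_scale t_e3 1"
  using hecke_relations(3)
  by (simp add: t_e1_def t_e2_def t_e3_def algebra_simps hecke_scale_mult)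

text \<open>The quadratic relation reads s (a - s) = b with b a unit; the cubic one reads t (t^2 -
  e1 t + e2) = e3 with e3 a unit. This yields both inverses.\<close>

definition s_inv :: hecke where
  "s_inv = hecke_scale s_det_inv (hecke_scale s_tr 1 - hecke_s)"

definition t_inv :: hecke where
  "t_inv = hecke_scale t_e3_inv
    (hecke_t * hecke_t - hecke_scale t_e1 hecke_t + hecke_scale t_e2 1)"

lemma s_mult_inv: "hecke_s * s_inv = 1" "s_inv * hecke_s = 1"
  using s_det_mult_inv
  by (simp_all add: s_inv_def right_diff_distrib left_diff_distrib hecke_scale_mult s_square
      mult.commute)

lemma t_mult_inv: "hecke_t * t_inv = 1" "t_inv * hecke_t = 1"
  using t_e3_mult_inv t_cube
  by (simp_all add: t_inv_def distrib_left distrib_right right_diff_distrib left_diff_distrib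
      hecke_scale_mult mult.commute mult.assoc)

lemma mult_inv_cancel:
  "hecke_s * (s_inv * x) = x" "s_inv * (hecke_s * x) = x"
  "hecke_t * (t_inv * x) = x" "t_inv * (hecke_t * x) = x"
  by (simp_all add: s_mult_inv t_mult_inv flip: mult.assoc)

lemmas inv_simps = s_mult_inv t_mult_inv mult_inv_cancel

lemma t_square:
  "hecke_t * hecke_t =
    hecke_scale t_e1 hecke_t - hecke_scale t_e2 1 + hecke_scale t_e3 t_inv"
  by (simp add: t_inv_def t_e3_mult_inv)

text \<open>The cubic relation divided by t^2. It serves at exponent 3, where the available
  sandwiches have \<open>t_inv\<close> and its square in the middle.\<close>

lemma t_eq_inv:
  "hecke_t = hecke_scale t_e1 1 - hecke_scale t_e2 t_inv + hecke_scale t_e3 (t_inv * t_inv)"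
proof -
  have "hecke_t = hecke_t * hecke_t * t_inv"
    by (simp add: mult.assoc inv_simps)
  also have "\<dots> = hecke_scale t_e1 1 - hecke_scale t_e2 t_inv + hecke_scale t_e3 (t_inv * t_inv)"
    unfolding t_square
    by (simp add: distrib_right left_diff_distrib hecke_scale_mult inv_simps)
  finally show ?thesis .
qed

lemma t_inv_square:
  "t_inv * t_inv =
    hecke_scale t_e3_inv (hecke_t - hecke_scale t_e1 1 + hecke_scale t_e2 t_inv)"
  using arg_cong[OF t_eq_inv, of "hecke_scale t_e3_inv"] t_e3_mult_inv
  by (simp add: hecke.scale_right_distrib hecke.scale_right_diff_distrib mult.commute)

lemma u1_subalgebra: "subalgebra hecke_u1" and u2_subalgebra: "subalgebra hecke_u2"
  unfolding hecke_u1_def hecke_u2_def by (rule subalgebra_hull)+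

lemmas u1_rules [intro, simp] = subalgebraD(2,3)[OF u1_subalgebra]
  hecke.subspace_add[OF subalgebraD(1)[OF u1_subalgebra]]
  hecke.subspace_diff[OF subalgebraD(1)[OF u1_subalgebra]]
  hecke.subspace_scale[OF subalgebraD(1)[OF u1_subalgebra]]

lemmas u2_rules [intro, simp] = subalgebraD(2,3)[OF u2_subalgebra]
  hecke.subspace_add[OF subalgebraD(1)[OF u2_subalgebra]]
  hecke.subspace_diff[OF subalgebraD(1)[OF u2_subalgebra]]
  hecke.subspace_scale[OF subalgebraD(1)[OF u2_subalgebra]]

lemma s_in_u1 [simp]: "hecke_s \<in> hecke_u1"
  unfolding hecke_u1_def by (simp add: hull_inc)

lemma t_in_u2 [simp]: "hecke_t \<in> hecke_u2"
  unfolding hecke_u2_def by (simp add: hull_inc)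

lemma s_inv_in_u1 [simp]: "s_inv \<in> hecke_u1"
  unfolding s_inv_def by simp

lemma t_inv_in_u2 [simp]: "t_inv \<in> hecke_u2"
  unfolding t_inv_def by simp

lemma u1_subset_span: "hecke_u1 \<subseteq> hecke.span {1, hecke_s}"
  unfolding hecke_u1_def
proof (rule hull_minimal)
  show "subalgebra (hecke.span {1, hecke_s})"
  proof (rule subalgebra_span)
    fix x y
    assume "x \<in> {1, hecke_s}" "y \<in> {1, hecke_s}"
    then show "x * y \<in> hecke.span {1, hecke_s}"
      by (auto simp: s_square hecke.span_base intro!: hecke.span_diff hecke.span_scale)
  qed (simp add: hecke.span_base)
qed (simp add: hecke.span_base)

text \<open>The basis with \<open>t_inv\<close> in place of t^2 suits the braid relation, which
  rewrites \<open>s t s\<close> and, with inverses throughout, its mirror image.\<close>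

lemma u2_subset_span: "hecke_u2 \<subseteq> hecke.span {1, hecke_t, t_inv}"
  unfolding hecke_u2_def
proof (rule hull_minimal)
  show "subalgebra (hecke.span {1, hecke_t, t_inv})"
  proof (rule subalgebra_span)
    fix x y
    assume "x \<in> {1, hecke_t, t_inv}" "y \<in> {1, hecke_t, t_inv}"
    then show "x * y \<in> hecke.span {1, hecke_t, t_inv}"
      by (auto simp: t_square t_inv_square inv_simps hecke.span_base
          intro!: hecke.span_diff hecke.span_add hecke.span_scale)
  qed (simp add: hecke.span_base)
qed (simp add: hecke.span_base)

section \<open>The central element\<close>

lemma z_eq_st: "hecke_z = hecke_s * (hecke_t * (hecke_s * (hecke_t * (hecke_s * hecke_t))))"
  by (simp add: hecke_z_def power3_eq_cube mult.assoc)

lemma z_eq_ts: "hecke_z = hecke_t * (hecke_s * (hecke_t * (hecke_s * (hecke_t * hecke_s))))"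
  using hecke_relations(1) by (simp add: z_eq_st mult.assoc)

lemma z_central: "hecke_z * x = x * hecke_z"
proof -
  let ?C = "{x. hecke_z * x = x * hecke_z}"
  have "subalgebra ?C"
    unfolding subalgebra_def hecke.subspace_def
    by (simp add: distrib_left distrib_right hecke_scale_mult) (metis mult.assoc)
  \<comment> \<open>With z = ststst on one side and z = tststs on the other, both products are the
    same alternating word of seven letters.\<close>
  moreover have "hecke_z * hecke_s = hecke_s * hecke_z"
    by (subst z_eq_st, subst z_eq_ts) (simp add: mult.assoc)
  moreover have "hecke_z * hecke_t = hecke_t * hecke_z"
    by (subst z_eq_ts, subst z_eq_st) (simp add: mult.assoc)
  ultimately have "?C = UNIV"
    by (intro subalgebra_eq_UNIV) auto
  then show ?thesis by blast
qed

lemma z_power_left_commute: "x * (hecke_z ^ k * y) = hecke_z ^ k * (x * y)"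
proof -
  have "x * hecke_z ^ k = hecke_z ^ k * x"
    using power_commuting_commutes[OF z_central] by simp
  then show ?thesis by (metis mult.assoc)
qed

text \<open>The inverses cancel the last three letters of ststst. Read from left to right, the
  identity raises the exponent of z by one; \<open>z_s_inv_t_inv_s_inv\<close> lowers it by
  one.\<close>

lemma sts_eq: "hecke_s * hecke_t * hecke_s = hecke_z * t_inv * s_inv * t_inv"
  by (simp add: z_eq_st mult.assoc inv_simps)

lemma z_s_inv_t_inv_s_inv: "hecke_z * s_inv * t_inv * s_inv = hecke_t * hecke_s * hecke_t"
proof -
  have "hecke_z * s_inv * t_inv * s_inv =
      hecke_t * (hecke_s * (hecke_t * (hecke_s * (hecke_t * (hecke_s * (s_inv * (t_inv * s_inv)))))))"
    by (subst z_eq_ts) (simp only: mult.assoc)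
  then show ?thesis
    by (simp add: inv_simps mult.assoc)
qed

lemma z_square_relation:
  "hecke_z ^ 2 * s_inv * (t_inv * t_inv) * s_inv =
    hecke_scale s_tr (hecke_z * hecke_t) -
    hecke_scale s_det (hecke_t * (hecke_s * (hecke_t * hecke_t) * hecke_s) * hecke_t)"
proof -
  have left: "hecke_z * s_inv * t_inv = hecke_t * hecke_s * hecke_t * hecke_s"
    by (subst z_eq_ts) (simp add: mult.assoc inv_simps)
  have right: "hecke_z * (t_inv * s_inv) = hecke_s * hecke_t * hecke_s * hecke_t"
    by (subst z_central, subst z_eq_st) (simp add: mult.assoc inv_simps)
  have "hecke_z ^ 2 * s_inv * (t_inv * t_inv) * s_inv =
      hecke_z * (hecke_z * (s_inv * t_inv)) * (t_inv * s_inv)"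
    by (simp add: power2_eq_square mult.assoc)
  \<comment> \<open>Centrality gives one factor z to each half of the word.\<close>
  also have "\<dots> = (hecke_z * s_inv * t_inv) * (hecke_z * (t_inv * s_inv))"
    by (subst z_central[of "hecke_z * (s_inv * t_inv)"]) (simp add: mult.assoc)
  \<comment> \<open>The halves tsts and stst meet in s^2, which the quadratic relation
    expands.\<close>
  also have "\<dots> = hecke_t * hecke_s * hecke_t * (hecke_s * hecke_s) * hecke_t * hecke_s * hecke_t"
    unfolding left right by (simp add: mult.assoc)
  also have "\<dots> = hecke_scale s_tr (hecke_t * hecke_s * hecke_t * hecke_s * hecke_t * hecke_s * hecke_t)
      - hecke_scale s_det (hecke_t * (hecke_s * (hecke_t * hecke_t) * hecke_s) * hecke_t)"
    unfolding s_square
    by (simp add: right_diff_distrib left_diff_distrib hecke_scale_mult mult.assoc)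
  also have "hecke_t * hecke_s * hecke_t * hecke_s * hecke_t * hecke_s * hecke_t = hecke_z * hecke_t"
    by (subst z_eq_ts) (simp add: mult.assoc)
  finally show ?thesis .
qed

section \<open>\<open>U\<close> is a right ideal\<close>

text \<open>A single span replaces the sum of iterated span products, so that closure can be checked
  on generators; the final theorem embeds it in \<open>hecke_U\<close>.\<close>

definition U_span :: "hecke set" where
  "U_span = hecke.span {hecke_z ^ k * x * y * w |k x y w.
    k \<le> 3 \<and> x \<in> hecke_u2 \<and> y \<in> hecke_u1 \<and> w \<in> hecke_u2}"

lemma U_spanI:
  "k \<le> 3 \<Longrightarrow> x \<in> hecke_u2 \<Longrightarrow> y \<in> hecke_u1 \<Longrightarrow> w \<in> hecke_u2 \<Longrightarrow>
    hecke_z ^ k * x * y * w \<in> U_span"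
  unfolding U_span_def by (rule hecke.span_base) blast

lemma U_span_subspace: "hecke.subspace U_span"
  unfolding U_span_def by simp

lemmas U_span_zero = hecke.subspace_0[OF U_span_subspace]
lemmas U_span_add = hecke.subspace_add[OF U_span_subspace]
lemmas U_span_diff = hecke.subspace_diff[OF U_span_subspace]
lemmas U_span_scale = hecke.subspace_scale[OF U_span_subspace]

lemma U_span_subspace_preimage: "hecke.subspace {x. a * x * b \<in> U_span}"
  unfolding hecke.subspace_def
  by (simp add: distrib_left distrib_right hecke_scale_mult U_span_zero U_span_add U_span_scale)

lemma U_span_mult_closed:
  assumes "\<And>k x y w. k \<le> 3 \<Longrightarrow> x \<in> hecke_u2 \<Longrightarrow> y \<in> hecke_u1 \<Longrightarrow> w \<in> hecke_u2 \<Longrightarrow>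
      a * (hecke_z ^ k * x * y * w) * b \<in> U_span"
    and "u \<in> U_span"
  shows "a * u * b \<in> U_span"
proof -
  have "U_span \<subseteq> {u. a * u * b \<in> U_span}"
    by (subst U_span_def, rule hecke.span_minimal) (use assms(1) U_span_subspace_preimage in blast)+
  with assms(2) show ?thesis by blast
qed

text \<open>Since \<open>hecke_z ^ k\<close> is central, the two outer factors are absorbed by the
  neighbouring factors from \<open>hecke_u2\<close>.\<close>

lemma U_span_mult_u2:
  assumes a: "a \<in> hecke_u2" and b: "b \<in> hecke_u2" and u: "u \<in> U_span"
  shows "a * u * b \<in> U_span"
proof (rule U_span_mult_closed[OF _ u])
  fix k :: nat and x y w
  assume "k \<le> 3" "x \<in> hecke_u2" "y \<in> hecke_u1" "w \<in> hecke_u2"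
  then have "hecke_z ^ k * (a * x) * y * (w * b) \<in> U_span"
    using a b by (intro U_spanI) auto
  then show "a * (hecke_z ^ k * x * y * w) * b \<in> U_span"
    by (simp add: mult.assoc z_power_left_commute)
qed

section \<open>Sandwiches \<open>s x s\<close> with \<open>x\<close> in \<open>hecke_u2\<close>,
  exponent by exponent\<close>

lemma s_inv_sandwich:
  "c * s_inv * x * s_inv = hecke_scale (s_det_inv * s_det_inv)
    (c * hecke_s * x * hecke_s - hecke_scale s_tr (c * hecke_s * x) - hecke_scale s_tr (c * x * hecke_s)
      + hecke_scale (s_tr * s_tr) (c * x))"
  by (simp add: s_inv_def algebra_simps hecke_scale_mult mult.assoc)

lemma s_sandwich:
  "c * hecke_s * x * hecke_s = hecke_scale (s_det * s_det) (c * s_inv * x * s_inv)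
    + hecke_scale s_tr (c * hecke_s * x) + hecke_scale s_tr (c * x * hecke_s)
    - hecke_scale (s_tr * s_tr) (c * x)"
proof -
  have "s_det * s_det * (s_det_inv * s_det_inv) = (s_det * s_det_inv) * (s_det * s_det_inv)"
    by (simp add: mult_ac)
  then have "s_det * s_det * (s_det_inv * s_det_inv) = 1"
    by (simp add: s_det_mult_inv)
  then show ?thesis
    by (simp add: s_inv_sandwich)
qed

lemma U_spanI_short:
  assumes "k \<le> 3" "x \<in> hecke_u2" "y \<in> hecke_u1"
  shows "hecke_z ^ k * x * y \<in> U_span" "hecke_z ^ k * y * x \<in> U_span" "hecke_z ^ k * x \<in> U_span"
  using U_spanI[OF assms(1,2,3), of 1] U_spanI[OF assms(1) _ assms(3,2), of 1]
    U_spanI[OF assms(1,2), of 1 1] assms by auto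

text \<open>As \<open>s_inv\<close> is an affine function of \<open>hecke_s\<close>, the two
  sandwiches agree up to a unit and terms with at most one factor s, which lie in
  \<open>U_span\<close>. So each case may use whichever form its relation fits.\<close>

lemma U_span_sandwich_iff:
  assumes "k \<le> 3" "x \<in> hecke_u2"
  shows "hecke_z ^ k * s_inv * x * s_inv \<in> U_span \<longleftrightarrow> hecke_z ^ k * hecke_s * x * hecke_s \<in> U_span"
proof
  assume "hecke_z ^ k * s_inv * x * s_inv \<in> U_span"
  then show "hecke_z ^ k * hecke_s * x * hecke_s \<in> U_span"
    by (subst s_sandwich) (intro U_span_add U_span_diff U_span_scale assms s_in_u1
      U_spanI_short(1)[OF assms(1) assms(2) s_in_u1] U_spanI_short(2)[OF assms s_in_u1]
      U_spanI_short(3)[OF assms s_in_u1])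
next
  assume "hecke_z ^ k * hecke_s * x * hecke_s \<in> U_span"
  then show "hecke_z ^ k * s_inv * x * s_inv \<in> U_span"
    by (subst s_inv_sandwich) (intro U_span_add U_span_diff U_span_scale assms s_in_u1
      U_spanI_short(1)[OF assms(1) assms(2) s_in_u1] U_spanI_short(2)[OF assms s_in_u1]
      U_spanI_short(3)[OF assms s_in_u1])
qed

lemma sandwich_one:
  assumes "k \<le> 3" "y \<in> hecke_u1"
  shows "hecke_z ^ k * y * 1 * y \<in> U_span"
  using U_spanI[OF assms(1), of 1 "y * y" 1] assms(2) by (simp add: mult.assoc)

text \<open>By \<open>sts_eq\<close> the exponent grows to k + 1, which must not exceed 3.\<close>

lemma sandwich_t_low:
  assumes "k \<le> 2"
  shows "hecke_z ^ k * hecke_s * hecke_t * hecke_s \<in> U_span"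
proof -
  have "hecke_z ^ k * hecke_s * hecke_t * hecke_s = hecke_z ^ k * (hecke_s * hecke_t * hecke_s)"
    by (simp add: mult.assoc)
  also have "\<dots> = hecke_z ^ Suc k * t_inv * s_inv * t_inv"
    unfolding sts_eq by (simp add: mult.assoc power_Suc2 del: power_Suc)
  finally show ?thesis
    using assms U_spanI[of "Suc k" t_inv s_inv t_inv] by simp
qed

text \<open>Here the exponent drops to k - 1, hence the lower bound on k.\<close>

lemma inv_sandwich_t_inv_high:
  assumes "1 \<le> k" "k \<le> 3"
  shows "hecke_z ^ k * s_inv * t_inv * s_inv \<in> U_span"
proof -
  obtain j where k: "k = Suc j" using assms(1) by (cases k) auto
  have "hecke_z ^ k * s_inv * t_inv * s_inv = hecke_z ^ j * (hecke_z * s_inv * t_inv * s_inv)"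
    by (simp add: k mult.assoc power_Suc2 del: power_Suc)
  also have "\<dots> = hecke_z ^ j * hecke_t * hecke_s * hecke_t"
    unfolding z_s_inv_t_inv_s_inv by (simp add: mult.assoc)
  finally show ?thesis
    using assms k U_spanI[of j hecke_t hecke_s hecke_t] by simp
qed

lemma sandwich_u2I:
  assumes "k \<le> 3" "hecke_z ^ k * y * hecke_t * y \<in> U_span" "hecke_z ^ k * y * t_inv * y \<in> U_span"
    and "y \<in> hecke_u1" "x \<in> hecke_u2"
  shows "hecke_z ^ k * y * x * y \<in> U_span"
proof -
  have "hecke.span {1, hecke_t, t_inv} \<subseteq> {x. (hecke_z ^ k * y) * x * y \<in> U_span}"
    by (rule hecke.span_minimal)
      (use assms sandwich_one U_span_subspace_preimage[of "hecke_z ^ k * y" y] in auto)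
  with assms(5) u2_subset_span show ?thesis by blast
qed

text \<open>At k = 1 and k = 2 both shifts of the exponent stay within 0 to 3: upwards for
  \<open>hecke_t\<close>, downwards for \<open>t_inv\<close> after passing to
  \<open>s_inv\<close>.\<close>

lemma sandwich_middle:
  assumes "1 \<le> k" "k \<le> 2" "x \<in> hecke_u2"
  shows "hecke_z ^ k * hecke_s * x * hecke_s \<in> U_span"
proof (rule sandwich_u2I)
  show "hecke_z ^ k * hecke_s * hecke_t * hecke_s \<in> U_span"
    by (rule sandwich_t_low) (rule assms)
  show "hecke_z ^ k * hecke_s * t_inv * hecke_s \<in> U_span"
    using assms U_span_sandwich_iff[of k t_inv] inv_sandwich_t_inv_high[of k] by simp
qed (use assms in simp_all)

text \<open>This form serves both extremes: k = 0 for the bottom exponent, k = 1 for the top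
  one.\<close>

lemma z_power_square_relation:
  "hecke_z ^ (k + 2) * s_inv * (t_inv * t_inv) * s_inv =
    hecke_scale s_tr (hecke_z ^ (k + 1) * hecke_t) -
    hecke_scale s_det (hecke_t * (hecke_z ^ k * hecke_s * (hecke_t * hecke_t) * hecke_s) * hecke_t)"
proof -
  have "hecke_z ^ (k + 2) * s_inv * (t_inv * t_inv) * s_inv =
      hecke_z ^ k * (hecke_z ^ 2 * s_inv * (t_inv * t_inv) * s_inv)"
    by (simp only: power_add mult.assoc)
  also have "\<dots> = hecke_scale s_tr (hecke_z ^ (k + 1) * hecke_t) -
      hecke_scale s_det (hecke_t * (hecke_z ^ k * hecke_s * (hecke_t * hecke_t) * hecke_s) * hecke_t)"
    unfolding z_square_relation
    by (simp add: right_diff_distrib hecke_scale_mult power_add mult.assoc z_power_left_commute)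
  finally show ?thesis .
qed

text \<open>Shifting down would give exponent -1, so the middle factor t^2 takes the place of
  \<open>t_inv\<close>, which is a combination of 1, t and t^2.\<close>

lemma sandwich_bottom:
  assumes "x \<in> hecke_u2"
  shows "hecke_z ^ 0 * hecke_s * x * hecke_s \<in> U_span"
proof -
  let ?c = "hecke_z ^ 0 * hecke_s"
  let ?w = "?c * (hecke_t * hecke_t) * hecke_s"
  have "hecke_z ^ (0 + 2) * s_inv * (t_inv * t_inv) * s_inv \<in> U_span"
    using U_span_sandwich_iff[of "0 + 2" "t_inv * t_inv"] sandwich_middle[of "0 + 2" "t_inv * t_inv"] by simp
  moreover have "hecke_z ^ (0 + 1) * hecke_t \<in> U_span"
    by (rule U_spanI_short(3)[of _ _ 1]) auto
  moreover have "hecke_scale s_det (hecke_t * ?w * hecke_t) =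
      hecke_scale s_tr (hecke_z ^ (0 + 1) * hecke_t) - hecke_z ^ (0 + 2) * s_inv * (t_inv * t_inv) * s_inv"
    unfolding z_power_square_relation by simp
  ultimately have "hecke_scale s_det (hecke_t * ?w * hecke_t) \<in> U_span"
    using U_span_diff U_span_scale by metis
  \<comment> \<open>Multiplication by \<open>t_inv\<close> on both sides and by
    \<open>s_det_inv\<close> strips everything from \<open>?w\<close>.\<close>
  then have "hecke_scale s_det_inv (t_inv * hecke_scale s_det (hecke_t * ?w * hecke_t) * t_inv) \<in> U_span"
    using U_span_mult_u2[OF t_inv_in_u2 t_inv_in_u2] U_span_scale by blast
  then have tt: "?w \<in> U_span"
    using s_det_mult_inv
    by (simp add: hecke_scale_mult mult.assoc inv_simps mult.commute[of s_det_inv])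
  have t: "?c * hecke_t * hecke_s \<in> U_span"
    by (rule sandwich_t_low) simp
  have "?c * t_inv * hecke_s = hecke_scale t_e3_inv
      (?w - hecke_scale t_e1 (?c * hecke_t * hecke_s) + hecke_scale t_e2 (?c * 1 * hecke_s))"
    by (simp add: t_inv_def distrib_left distrib_right right_diff_distrib left_diff_distrib
        hecke_scale_mult)
  also have "\<dots> \<in> U_span"
    by (intro U_span_scale U_span_add U_span_diff tt t sandwich_one) auto
  finally show ?thesis
    using sandwich_u2I[OF _ t _ s_in_u1 assms] by blast
qed

text \<open>Shifting up would give exponent 4, so the sandwich is taken between copies of
  \<open>s_inv\<close>, and t is written through 1, \<open>t_inv\<close> and its square.\<close>

lemma sandwich_top:
  assumes "x \<in> hecke_u2"
  shows "hecke_z ^ 3 * hecke_s * x * hecke_s \<in> U_span"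
proof -
  let ?c = "hecke_z ^ 3 * s_inv"
  have "?c * (t_inv * t_inv) * s_inv = hecke_z ^ (1 + 2) * s_inv * (t_inv * t_inv) * s_inv"
    by (simp add: power3_eq_cube mult.assoc)
  also have "\<dots> \<in> U_span"
    \<comment> \<open>The right-hand side has a term at exponent 2 without s and a sandwich at
      exponent 1, covered by \<open>sandwich_middle\<close>.\<close>
    unfolding z_power_square_relation
    by (intro U_span_diff U_span_scale U_span_mult_u2 sandwich_middle U_spanI_short(3)[of _ _ 1]) auto
  finally have tt: "?c * (t_inv * t_inv) * s_inv \<in> U_span" .
  have t: "?c * t_inv * s_inv \<in> U_span"
    by (rule inv_sandwich_t_inv_high) auto
  have "?c * hecke_t * s_inv =
      hecke_scale t_e1 (?c * 1 * s_inv) - hecke_scale t_e2 (?c * t_inv * s_inv)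
      + hecke_scale t_e3 (?c * (t_inv * t_inv) * s_inv)"
    by (subst t_eq_inv)
      (simp add: distrib_left distrib_right right_diff_distrib left_diff_distrib hecke_scale_mult)
  also have "\<dots> \<in> U_span"
    by (intro U_span_scale U_span_add U_span_diff tt t sandwich_one) auto
  finally have "?c * x * s_inv \<in> U_span"
    using sandwich_u2I[OF _ _ t s_inv_in_u1 assms] by blast
  then show ?thesis
    using U_span_sandwich_iff assms by blast
qed

lemma sandwich:
  assumes "k \<le> 3" "x \<in> hecke_u2"
  shows "hecke_z ^ k * hecke_s * x * hecke_s \<in> U_span"
proof -
  consider "k = 0" | "1 \<le> k \<and> k \<le> 2" | "k = 3" using assms(1) by linarith
  then show ?thesis
    using sandwich_bottom sandwich_middle sandwich_top assms(2) by cases blast+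
qed

text \<open>In a generator times s, the factor y may be taken to be 1 or s, and y = s gives a
  sandwich. The left factor x is set aside and restored by \<open>U_span_mult_u2\<close>.\<close>

lemma U_span_mult_s:
  assumes u: "u \<in> U_span"
  shows "u * hecke_s \<in> U_span"
proof -
  have "1 * u * hecke_s \<in> U_span"
  proof (rule U_span_mult_closed[OF _ u])
    fix k :: nat and x y w
    assume k: "k \<le> 3" and x: "x \<in> hecke_u2" and y: "y \<in> hecke_u1" and w: "w \<in> hecke_u2"
    have "hecke.span {1, hecke_s} \<subseteq> {y. hecke_z ^ k * y * (w * hecke_s) \<in> U_span}"
      by (rule hecke.span_minimal)
        (use k w sandwich U_spanI_short(1) U_span_subspace_preimage[of "hecke_z ^ k" "w * hecke_s"]
          in \<open>auto simp flip: mult.assoc\<close>)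
    then have "hecke_z ^ k * y * (w * hecke_s) \<in> U_span"
      using y u1_subset_span by blast
    then have "x * (hecke_z ^ k * y * (w * hecke_s)) * 1 \<in> U_span"
      using x U_span_mult_u2[of x 1] by blast
    then show "1 * (hecke_z ^ k * x * y * w) * hecke_s \<in> U_span"
      by (simp add: mult.assoc z_power_left_commute)
  qed
  then show ?thesis by simp
qed

text \<open>The right multipliers preserving \<open>U_span\<close> form a subalgebra containing both
  generators, hence everything; apply them to 1.\<close>

lemma U_span_UNIV: "U_span = UNIV"
proof -
  let ?A = "{x. \<forall>u\<in>U_span. u * x \<in> U_span}"
  have "subalgebra ?A"
    unfolding subalgebra_def hecke.subspace_def
    by (auto simp: distrib_left hecke_scale_mult U_span_zero U_span_add U_span_scale
        simp flip: mult.assoc)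
  moreover have "hecke_t \<in> ?A"
    using U_span_mult_u2[of 1 hecke_t] by simp
  ultimately have "?A = UNIV"
    using U_span_mult_s by (intro subalgebra_eq_UNIV) auto
  moreover have "1 \<in> U_span"
    using U_spanI[of 0 1 1 1] by simp
  ultimately show ?thesis
    by (metis (no_types, lifting) UNIV_I UNIV_eq_I mem_Collect_eq mult_1)
qed

section \<open>Comparison with the sum of submodules \<open>hecke_U\<close>\<close>

lemma span_prodI: "x \<in> X \<Longrightarrow> y \<in> Y \<Longrightarrow> x * y \<in> X \<odot> Y"
  unfolding span_prod_def by (rule hecke.span_base) blast


lemma subspace_set_plus:
  assumes X: "hecke.subspace X" and Y: "hecke.subspace Y"
  shows "hecke.subspace (X + Y)"
  unfolding hecke.subspace_def
proof (intro conjI ballI allI)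
  show "0 \<in> X + Y"
    using set_plus_intro[OF hecke.subspace_0[OF X] hecke.subspace_0[OF Y]] by simp
  show "u + v \<in> X + Y" if "u \<in> X + Y" "v \<in> X + Y" for u v
    using that
  proof (elim set_plus_elim)
    fix a b c d
    assume "u = a + b" "v = c + d" and abcd: "a \<in> X" "b \<in> Y" "c \<in> X" "d \<in> Y"
    then have "u + v = (a + c) + (b + d)"
      by (simp add: algebra_simps)
    then show "u + v \<in> X + Y"
      using abcd by (simp only: set_plus_intro hecke.subspace_add[OF X] hecke.subspace_add[OF Y])
  qed
  show "hecke_scale r u \<in> X + Y" if "u \<in> X + Y" for r u
    using that
  proof (elim set_plus_elim)
    fix a b
    assume "u = a + b" "a \<in> X" "b \<in> Y"
    then show "hecke_scale r u \<in> X + Y"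
      by (simp only: hecke.scale_right_distrib set_plus_intro
          hecke.subspace_scale[OF X] hecke.subspace_scale[OF Y])
  qed
qed

text \<open>A summand embeds in the sum because the remaining summands contain 0.\<close>

lemma sum_subspaces:
  fixes A :: "'i \<Rightarrow> hecke set"
  assumes "finite I" "\<And>i. i \<in> I \<Longrightarrow> hecke.subspace (A i)"
  shows "hecke.subspace (\<Sum>i\<in>I. A i) \<and> (\<forall>i\<in>I. A i \<subseteq> (\<Sum>i\<in>I. A i))"
  using assms
proof (induction I)
  case empty
  show ?case by (simp add: set_zero)
next
  case (insert j I)
  let ?S = "\<Sum>i\<in>I. A i"
  have S: "hecke.subspace ?S" "\<forall>i\<in>I. A i \<subseteq> ?S" and Aj: "hecke.subspace (A j)"
    using insert by auto
  have "hecke.subspace (A j + ?S)"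
    by (rule subspace_set_plus[OF Aj S(1)])
  moreover have "A j \<subseteq> A j + ?S" "?S \<subseteq> A j + ?S"
    using set_zero_plus2[OF hecke.subspace_0[OF S(1)], of "A j"]
      set_zero_plus2[OF hecke.subspace_0[OF Aj], of ?S] by (simp_all add: add.commute)
  ultimately show ?case
    using insert.hyps S(2) by auto
qed

theorem theorem4p2p8:
  shows "(UNIV :: hecke set) = hecke_U"
proof -
  let ?A = "\<lambda>k. {hecke_z ^ k} \<odot> hecke_u2 \<odot> hecke_u1 \<odot> hecke_u2"
  have "hecke.subspace (\<Sum>k = 0..3. ?A k) \<and> (\<forall>k\<in>{0..3}. ?A k \<subseteq> (\<Sum>k = 0..3. ?A k))"
    by (rule sum_subspaces) (auto simp: span_prod_def)
  then have "hecke.subspace hecke_U" and A: "\<And>k. k \<le> 3 \<Longrightarrow> ?A k \<subseteq> hecke_U"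
    unfolding hecke_U_def by auto
  moreover have "hecke_z ^ k * x * y * w \<in> hecke_U"
    if "k \<le> 3" "x \<in> hecke_u2" "y \<in> hecke_u1" "w \<in> hecke_u2" for k x y w
    using A[OF that(1)] that by (blast intro: span_prodI)
  \<comment> \<open>Since \<open>U_span\<close> is everything, this inclusion gives the
    equality.\<close>
  ultimately have "U_span \<subseteq> hecke_U"
    unfolding U_span_def by (intro hecke.span_minimal) blast+
  then show ?thesis
    using U_span_UNIV by blast
qed

end
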